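(* Let $\alpha,\beta\in(0,\infty]$, let $n\ge1$ (with $n\ge2$ if $\alpha=\beta=\infty$), and let $i,j\ge1$ with $i+j\le n+1$. The subtableau $S_{n,\alpha,\beta}[i,j]$ of the random $\alpha/\beta$-staircase tableau $S_{n,\alpha,\beta}$ has the same distribution as $S_{n-i-j+2,\hat\alpha,\hat\beta}$, where $\hat\alpha^{-1}=\alpha^{-1}+i-1$ and $\hat\beta^{-1}=\beta^{-1}+j-1$ (with $\infty^{-1}=0$ and $0^{-1}=\infty$).
   Context: An $\alpha/\beta$-staircase tableau of size $n\ge1$ is a filling of the Young diagram of shape $(n,n-1,\dots,2,1)$, whose boxes are $(i,j)$ (row $i$ from the top, column $j$ from the left) with $i,j\ge1$, $i+j\le n+1$, such that: each box is empty or contains one of the symbols $\alpha,\beta$; no diagonal box (box with $i+j=n+1$) is empty; all boxes in the same row and to the left of a $\beta$ are empty; all boxes in the same column and above an $\alpha$ are empty. Let $\bar{\mathcal S}_n$ be the set of these tableaux. For $S\in\bar{\mathcal S}_n$ let $N_\alpha(S),N_\beta(S)$ be the numbers of symbols $\alpha$ and $\beta$ in $S$. For parameter values $\alpha,\beta\in(0,\infty)$, $S_{n,\alpha,\beta}$ is the random element of $\bar{\mathcal S}_n$ with $\mathbb P(S_{n,\alpha,\beta}=S)=\alpha^{N_\alpha(S)}\beta^{N_\beta(S)}/Z_n(\alpha,\beta)$, where $Z_n(\alpha,\beta)=\sum_{S\in\bar{\mathcal S}_n}\alpha^{N_\alpha(S)}\beta^{N_\beta(S)}$. If exactly one of $\alpha,\beta$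 is $\infty$, the distribution is the limit of this one as that parameter tends to $\infty$ with the other fixed; if $\alpha=\beta=\infty$, it is the limit as $\alpha=\beta\to\infty$. For $S\in\bar{\mathcal S}_n$ and a box $(i,j)$ of $S$, $S[i,j]\in\bar{\mathcal S}_{n-i-j+2}$ denotes the subtableau with $(i,j)$ as its top left box, i.e. the one obtained by deleting the first (top) $i-1$ rows and the first (leftmost) $j-1$ columns of $S$. *)

theory Defs
  imports "HOL-Probability.Probability"
begin

datatype symbol = Alpha | Beta

text \<open>A filling assigns to a box (row, column), both counted from 1, its symbol or
  \<open>None\<close> if the box is empty; the positions outside the diagram carry \<open>None\<close>, so that
  each filling of a diagram is represented by exactly one function.\<close>

type_synonym filling = "nat \<times> nat \<Rightarrow> symbol option"

definition boxes :: "nat \<Rightarrow> (nat \<times> nat) set" where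
  "boxes n = {(i, j). 1 \<le> i \<and> 1 \<le> j \<and> i + j \<le> n + 1}"

definition staircase_tableaux :: "nat \<Rightarrow> filling set" where
  "staircase_tableaux n = {S.
     (\<forall>x. x \<notin> boxes n \<longrightarrow> S x = None) \<and>
     (\<forall>i j. (i, j) \<in> boxes n \<and> i + j = n + 1 \<longrightarrow> S (i, j) \<noteq> None) \<and>
     (\<forall>i j. S (i, j) = Some Beta \<longrightarrow> (\<forall>l<j. S (i, l) = None)) \<and>
     (\<forall>i j. S (i, j) = Some Alpha \<longrightarrow> (\<forall>k<i. S (k, j) = None))}"

definition N_alpha :: "filling \<Rightarrow> nat" where
  "N_alpha S = card {x. S x = Some Alpha}"

definition N_beta :: "filling \<Rightarrow> nat" where
  "N_beta S = card {x. S x = Some Beta}"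

definition weight :: "real \<Rightarrow> real \<Rightarrow> filling \<Rightarrow> real" where
  "weight a b S = a ^ N_alpha S * b ^ N_beta S"

definition Z :: "nat \<Rightarrow> real \<Rightarrow> real \<Rightarrow> real" where
  "Z n a b = (\<Sum>S\<in>staircase_tableaux n. weight a b S)"

definition tableau_pmf_real :: "nat \<Rightarrow> real \<Rightarrow> real \<Rightarrow> filling pmf" where
  "tableau_pmf_real n a b =
     embed_pmf (\<lambda>S. if S \<in> staircase_tableaux n then weight a b S / Z n a b else 0)"

text \<open>The limit in distribution of discrete distributions as the real parameter tends to
  infinity, expressed by convergence of all point probabilities. It is unspecified if there
  is no limiting probability distribution; \<open>tableau_pmf_alpha_infinity\<close>,
  \<open>tableau_pmf_beta_infinity\<close> and \<open>tableau_pmf_both_infinity\<close> below show that this does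
  not occur here.\<close>

definition pmf_limit :: "(real \<Rightarrow> 'a pmf) \<Rightarrow> 'a pmf" where
  "pmf_limit P = (THE p. \<forall>x. ((\<lambda>t. pmf (P t) x) \<longlongrightarrow> pmf p x) at_top)"

definition tableau_pmf :: "nat \<Rightarrow> ennreal \<Rightarrow> ennreal \<Rightarrow> filling pmf" where
  "tableau_pmf n \<alpha> \<beta> =
     (if \<alpha> \<noteq> \<infinity> \<and> \<beta> \<noteq> \<infinity> then tableau_pmf_real n (enn2real \<alpha>) (enn2real \<beta>)
      else if \<beta> \<noteq> \<infinity> then pmf_limit (\<lambda>t. tableau_pmf_real n t (enn2real \<beta>))
      else if \<alpha> \<noteq> \<infinity> then pmf_limit (\<lambda>t. tableau_pmf_real n (enn2real \<alpha>) t)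
      else pmf_limit (\<lambda>t. tableau_pmf_real n t t))"

text \<open>The guard keeps row 0 and column 0, which are outside the diagram, empty.\<close>

definition subtableau :: "nat \<Rightarrow> nat \<Rightarrow> filling \<Rightarrow> filling" where
  "subtableau i j S =
     (\<lambda>(k, l). if 1 \<le> k \<and> 1 \<le> l then S (k + (i - 1), l + (j - 1)) else None)"

lemma finite_boxes: "finite (boxes n)"
  by (rule finite_subset[of _ "{..n+1} \<times> {..n+1}"]) (auto simp: boxes_def)

lemma finite_staircase_tableaux: "finite (staircase_tableaux n)"
proof (rule finite_subset)
  show "staircase_tableaux n \<subseteq>
      {S. \<forall>x. (x \<in> boxes n \<longrightarrow> S x \<in> {None, Some Alpha, Some Beta}) \<and> (x \<notin> boxes n \<longrightarrow> S x = None)}"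
  proof -
    have "s \<in> {None, Some Alpha, Some Beta}" for s :: "symbol option"
      by (cases s; cases "the s") auto
    then show ?thesis by (simp add: staircase_tableaux_def subset_iff)
  qed
  show "finite \<dots>"
    by (rule finite_set_of_finite_funs) (simp_all add: finite_boxes)
qed

lemma staircase_tableaux_nonempty: "staircase_tableaux n \<noteq> {}"
proof -
  have "(\<lambda>(i, j). if (i, j) \<in> boxes n \<and> i + j = n + 1 then Some Alpha else None)
      \<in> staircase_tableaux n"
    by (auto simp: staircase_tableaux_def split: if_splits)
  then show ?thesis by blast
qed

lemma weight_pos: "a > 0 \<Longrightarrow> b > 0 \<Longrightarrow> weight a b S > 0"
  by (simp add: weight_def)

lemma Z_pos: "a > 0 \<Longrightarrow> b > 0 \<Longrightarrow> Z n a b > 0"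
  unfolding Z_def
  by (intro sum_pos finite_staircase_tableaux staircase_tableaux_nonempty weight_pos)

lemma pmf_embed_finite:
  fixes f :: "'a \<Rightarrow> real"
  assumes "finite X" "\<And>x. x \<in> X \<Longrightarrow> f x \<ge> 0" "(\<Sum>x\<in>X. f x) = 1"
  shows "pmf (embed_pmf (\<lambda>x. if x \<in> X then f x else 0)) x = (if x \<in> X then f x else 0)"
proof (rule pmf_embed_pmf)
  show "0 \<le> (if x \<in> X then f x else 0)" for x using assms(2) by simp
  have "(\<integral>\<^sup>+ x. ennreal (if x \<in> X then f x else 0) \<partial>count_space UNIV)
      = (\<Sum>x\<in>X. ennreal (if x \<in> X then f x else 0))"
    by (rule nn_integral_count_space') (use assms(1) in auto)
  also have "\<dots> = (\<Sum>x\<in>X. ennreal (f x))" by (intro sum.cong) auto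
  also have "\<dots> = ennreal (\<Sum>x\<in>X. f x)" using assms(2) by (intro sum_ennreal) auto
  finally show "(\<integral>\<^sup>+ x. ennreal (if x \<in> X then f x else 0) \<partial>count_space UNIV) = 1"
    using assms(3) by simp
qed

lemma pmf_tableau_pmf_real:
  assumes "a > 0" "b > 0"
  shows "pmf (tableau_pmf_real n a b) S =
    (if S \<in> staircase_tableaux n then weight a b S / Z n a b else 0)"
  unfolding tableau_pmf_real_def
proof (rule pmf_embed_finite)
  show "(\<Sum>S\<in>staircase_tableaux n. weight a b S / Z n a b) = 1"
    using Z_pos[OF assms, of n] by (simp add: sum_divide_distrib[symmetric] Z_def[symmetric])
qed (use assms finite_staircase_tableaux weight_pos Z_pos in \<open>auto intro: less_imp_le\<close>)

lemma pmf_limit_eqI: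
  assumes "\<And>x. ((\<lambda>t. pmf (P t) x) \<longlongrightarrow> pmf p x) at_top"
  shows "pmf_limit P = p"
  unfolding pmf_limit_def
proof (rule the_equality)
  fix q assume "\<forall>x. ((\<lambda>t. pmf (P t) x) \<longlongrightarrow> pmf q x) at_top"
  then show "q = p"
    by (intro pmf_eqI) (metis assms tendsto_unique trivial_limit_at_top_linorder)
qed (use assms in blast)

lemma pmf_limit_monomial_weights:
  fixes c :: "'a \<Rightarrow> real" and k :: "'a \<Rightarrow> nat"
  assumes X: "finite X" "X \<noteq> {}" and c: "\<And>x. x \<in> X \<Longrightarrow> c x > 0"
    and P: "\<And>t x. t > 0 \<Longrightarrow>
      pmf (P t) x = (if x \<in> X then t ^ k x * c x / (\<Sum>y\<in>X. t ^ k y * c y) else 0)"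
  shows "((\<lambda>t. pmf (P t) x) \<longlongrightarrow> pmf (pmf_limit P) x) at_top"
proof -
  define K where "K = Max (k ` X)"
  define d where "d = (\<lambda>x. if k x = K then c x else 0)"
  have k_le: "k y \<le> K" if "y \<in> X" for y
    using X that by (simp add: K_def)
  have "K \<in> k ` X" unfolding K_def using X by (intro Max_in) auto
  then obtain m where m: "m \<in> X" "k m = K" by auto
  have d_nonneg: "d y \<ge> 0" if "y \<in> X" for y
    using c[OF that] by (simp add: d_def)
  have sum_pos: "(\<Sum>y\<in>X. d y) > 0"
    by (rule sum_pos2[of X m]) (use X m c d_nonneg in \<open>auto simp: d_def\<close>)
  have lim: "((\<lambda>t::real. t ^ k y * c y / t ^ K) \<longlongrightarrow> d y) at_top" if "y \<in> X" for y
  proof -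
    have ev: "\<forall>\<^sub>F t::real in at_top. inverse t ^ (K - k y) * c y = t ^ k y * c y / t ^ K"
      using eventually_gt_at_top[of 0]
    proof eventually_elim
      case (elim t)
      have "t ^ K = t ^ k y * t ^ (K - k y)"
        using k_le[OF that] by (simp add: power_add[symmetric])
      then show ?case using elim by (simp add: field_simps)
    qed
    have "((\<lambda>t::real. inverse t ^ (K - k y) * c y) \<longlongrightarrow> 0 ^ (K - k y) * c y) at_top"
      by (intro tendsto_intros tendsto_inverse_0_at_top filterlim_ident)
    moreover have "0 ^ (K - k y) * c y = d y"
      using k_le[OF that] by (auto simp: d_def power_0_left)
    ultimately show ?thesis using ev by (simp add: tendsto_cong)
  qed
  define p where "p = embed_pmf (\<lambda>x. if x \<in> X then d x / (\<Sum>y\<in>X. d y) else 0)"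
  have p: "pmf p x = (if x \<in> X then d x / (\<Sum>y\<in>X. d y) else 0)" for x
    unfolding p_def
  proof (rule pmf_embed_finite)
    show "(\<Sum>x\<in>X. d x / (\<Sum>y\<in>X. d y)) = 1"
      using sum_pos by (simp add: sum_divide_distrib[symmetric])
  qed (use X d_nonneg sum_pos in \<open>auto simp: less_imp_le\<close>)
  have conv: "((\<lambda>t. pmf (P t) x) \<longlongrightarrow> pmf p x) at_top" for x
  proof (cases "x \<in> X")
    case True
    have "((\<lambda>t::real. (t ^ k x * c x / t ^ K) / (\<Sum>y\<in>X. t ^ k y * c y / t ^ K))
        \<longlongrightarrow> d x / (\<Sum>y\<in>X. d y)) at_top"
      by (intro tendsto_divide tendsto_sum lim True) (use sum_pos in auto)
    moreover have "\<forall>\<^sub>F t::real in at_top. pmf (P t) x =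
        (t ^ k x * c x / t ^ K) / (\<Sum>y\<in>X. t ^ k y * c y / t ^ K)"
      using eventually_gt_at_top[of 0]
    proof eventually_elim
      case (elim t)
      then show ?case using True
        by (simp add: P sum_divide_distrib[symmetric])
    qed
    ultimately show ?thesis using True by (simp add: p tendsto_cong)
  next
    case False
    have "\<forall>\<^sub>F t::real in at_top. pmf (P t) x = 0"
      using eventually_gt_at_top[of 0] by eventually_elim (simp add: P False)
    then show ?thesis using False by (simp add: p tendsto_eventually)
  qed
  then have "pmf_limit P = p" by (rule pmf_limit_eqI)
  then show ?thesis using conv by simp
qed

lemma tableau_pmf_alpha_infinity:
  assumes "0 < \<beta>" "\<beta> \<noteq> \<infinity>"
  shows "((\<lambda>t. pmf (tableau_pmf_real n t (enn2real \<beta>)) S) \<longlongrightarrow> pmf (tableau_pmf n \<infinity> \<beta>) S) at_top"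
proof -
  have b: "enn2real \<beta> > 0" using assms by (simp add: enn2real_positive_iff less_top)
  have "tableau_pmf n \<infinity> \<beta> = pmf_limit (\<lambda>t. tableau_pmf_real n t (enn2real \<beta>))"
    using assms by (simp add: tableau_pmf_def)
  then show ?thesis
    by (simp only:, intro pmf_limit_monomial_weights[where X = "staircase_tableaux n"
          and k = N_alpha and c = "\<lambda>S. enn2real \<beta> ^ N_beta S"])
       (use b in \<open>auto simp: finite_staircase_tableaux staircase_tableaux_nonempty
          pmf_tableau_pmf_real weight_def Z_def\<close>)
qed

lemma tableau_pmf_beta_infinity:
  assumes "0 < \<alpha>" "\<alpha> \<noteq> \<infinity>"
  shows "((\<lambda>t. pmf (tableau_pmf_real n (enn2real \<alpha>) t) S) \<longlongrightarrow> pmf (tableau_pmf n \<alpha> \<infinity>) S) at_top"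
proof -
  have a: "enn2real \<alpha> > 0" using assms by (simp add: enn2real_positive_iff less_top)
  have "tableau_pmf n \<alpha> \<infinity> = pmf_limit (\<lambda>t. tableau_pmf_real n (enn2real \<alpha>) t)"
    using assms by (simp add: tableau_pmf_def)
  then show ?thesis
    by (simp only:, intro pmf_limit_monomial_weights[where X = "staircase_tableaux n"
          and k = N_beta and c = "\<lambda>S. enn2real \<alpha> ^ N_alpha S"])
       (use a in \<open>auto simp: finite_staircase_tableaux staircase_tableaux_nonempty
          pmf_tableau_pmf_real weight_def Z_def mult.commute\<close>)
qed

lemma tableau_pmf_both_infinity:
  "((\<lambda>t. pmf (tableau_pmf_real n t t) S) \<longlongrightarrow> pmf (tableau_pmf n \<infinity> \<infinity>) S) at_top"
proof -
  have "tableau_pmf n \<infinity> \<infinity> = pmf_limit (\<lambda>t. tableau_pmf_real n t t)"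
    by (simp add: tableau_pmf_def)
  then show ?thesis
    by (simp only:, intro pmf_limit_monomial_weights[where X = "staircase_tableaux n"
          and k = "\<lambda>S. N_alpha S + N_beta S" and c = "\<lambda>S. 1"])
       (auto simp: finite_staircase_tableaux staircase_tableaux_nonempty
          pmf_tableau_pmf_real weight_def Z_def power_add)
qed

end

theory Submission
  imports Defs
begin

text \<open>Work with the inverse parameters \<open>x = 1/\<alpha>\<close> and \<open>y = 1/\<beta>\<close>. The boxes above an \<open>\<alpha>\<close>
  are empty, so a column contains at most one \<open>\<alpha>\<close>; likewise a row contains at most one
  \<open>\<beta>\<close>. Hence the weight of a tableau of size \<open>n\<close> is \<open>(\<alpha> \<beta>)\<^sup>n\<close> times
  \<open>x\<close> to the number of columns without \<open>\<alpha>\<close> times \<open>y\<close> to the number of rows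
  without \<open>\<beta>\<close>; the law of the random tableau is proportional to this monomial in
  \<open>x\<close> and \<open>y\<close>, the free weight.

  Delete the first column of a tableau of size \<open>n + 1\<close> and let \<open>T\<close> be the rest, with \<open>u\<close>
  rows free of \<open>\<beta>\<close>. The deleted column must be empty in every row where \<open>T\<close> has a
  \<open>\<beta>\<close>, may carry symbols in the \<open>u\<close> other rows, and must carry one in its bottom box.
  Summing the contributions of all admissible columns replaces the factor \<open>y ^ u\<close> by
  \<open>(x + y) * (y + 1) ^ u\<close> (\<open>sum_col_weight\<close>). So the total free weight of the tableaux over
  \<open>T\<close> is \<open>x + y\<close> times the free weight of \<open>T\<close> at \<open>(x, y + 1)\<close>
  (\<open>sum_free_weight_delete_col\<close>): deleting the first column changes \<open>1/\<beta>\<close> to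
  \<open>1/\<beta> + 1\<close> and keeps \<open>\<alpha>\<close>. Reflection in the diagonal, which exchanges the two
  symbols, gives the statement for the first row, and iteration gives all subtableaux
  (\<open>map_subtableau_free_law\<close>).

  The free weight makes sense at \<open>x = 0\<close> and at \<open>y = 0\<close>, and its sum over all tableaux
  is positive unless both vanish. One infinite parameter is therefore covered by the same
  computation, once continuity has identified the limiting distribution
  (\<open>tableau_pmf_eq_free_law\<close>). At \<open>x = y = 0\<close> the normalization breaks down, and the case
  \<open>\<alpha> = \<beta> = \<infinity>\<close> follows by letting \<open>\<alpha> = \<beta> \<rightarrow> \<infinity>\<close> on both
  sides of the identity for finite parameters.\<close>

section \<open>Tableaux weighted by their free columns and rows\<close>

definition alpha_free_cols :: "nat \<Rightarrow> filling \<Rightarrow> nat set" where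
  "alpha_free_cols n S = {l \<in> {1..n}. \<forall>k. S (k, l) \<noteq> Some Alpha}"

definition beta_free_rows :: "nat \<Rightarrow> filling \<Rightarrow> nat set" where
  "beta_free_rows n S = {k \<in> {1..n}. \<forall>l. S (k, l) \<noteq> Some Beta}"

text \<open>The arguments \<open>x\<close> and \<open>y\<close> stand for \<open>1/\<alpha>\<close> and \<open>1/\<beta>\<close>; in this form the weight is
  a polynomial that can be evaluated at an infinite parameter.\<close>

definition free_weight :: "nat \<Rightarrow> real \<Rightarrow> real \<Rightarrow> filling \<Rightarrow> real" where
  "free_weight n x y S = x ^ card (alpha_free_cols n S) * y ^ card (beta_free_rows n S)"

lemma finite_alpha_free_cols [simp]: "finite (alpha_free_cols n S)"
  by (simp add: alpha_free_cols_def)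

lemma finite_beta_free_rows [simp]: "finite (beta_free_rows n S)"
  by (simp add: beta_free_rows_def)

lemma tableau_symbol_in_boxes:
  "S \<in> staircase_tableaux n \<Longrightarrow> S (k, l) = Some s \<Longrightarrow> (k, l) \<in> boxes n"
  unfolding staircase_tableaux_def mem_Collect_eq by (metis option.distinct(1))

lemma tableau_diagonal:
  "S \<in> staircase_tableaux n \<Longrightarrow> 1 \<le> k \<Longrightarrow> 1 \<le> l \<Longrightarrow> k + l = n + 1 \<Longrightarrow> S (k, l) \<noteq> None"
proof -
  assume "S \<in> staircase_tableaux n" "1 \<le> k" "1 \<le> l" and kl: "k + l = n + 1"
  then have "(k, l) \<in> boxes n" by (simp add: boxes_def)
  with kl \<open>S \<in> staircase_tableaux n\<close> show ?thesis
    unfolding staircase_tableaux_def mem_Collect_eq by blast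
qed

lemma tableau_left_of_Beta:
  "S \<in> staircase_tableaux n \<Longrightarrow> S (k, l) = Some Beta \<Longrightarrow> l' < l \<Longrightarrow> S (k, l') = None"
  unfolding staircase_tableaux_def mem_Collect_eq by blast

lemma tableau_above_Alpha:
  "S \<in> staircase_tableaux n \<Longrightarrow> S (k, l) = Some Alpha \<Longrightarrow> k' < k \<Longrightarrow> S (k', l) = None"
  unfolding staircase_tableaux_def mem_Collect_eq by blast

lemma tableau_outside:
  "S \<in> staircase_tableaux n \<Longrightarrow> k = 0 \<or> l = 0 \<or> n + 1 < k + l \<Longrightarrow> S (k, l) = None"
  using tableau_symbol_in_boxes[of S n k l] by (cases "S (k, l)") (auto simp: boxes_def)

lemma tableauI:
  assumes "\<And>k l. k = 0 \<or> l = 0 \<or> n + 1 < k + l \<Longrightarrow> S (k, l) = None"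
    and "\<And>k l. 1 \<le> k \<Longrightarrow> 1 \<le> l \<Longrightarrow> k + l = n + 1 \<Longrightarrow> S (k, l) \<noteq> None"
    and "\<And>k l l'. S (k, l) = Some Beta \<Longrightarrow> l' < l \<Longrightarrow> S (k, l') = None"
    and "\<And>k l k'. S (k, l) = Some Alpha \<Longrightarrow> k' < k \<Longrightarrow> S (k', l) = None"
  shows "S \<in> staircase_tableaux n"
  unfolding staircase_tableaux_def mem_Collect_eq
proof (intro conjI allI impI)
  fix p assume "p \<notin> boxes n"
  then show "S p = None"
    using assms(1)[of "fst p" "snd p"] by (cases p) (auto simp: boxes_def not_le)
next
  fix k l assume "(k, l) \<in> boxes n \<and> k + l = n + 1"
  then show "S (k, l) \<noteq> None" using assms(2)[of k l] by (auto simp: boxes_def)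
qed (fact assms(3,4))+

text \<open>Every column contains at most one \<open>\<alpha>\<close>, because the boxes above an \<open>\<alpha>\<close> are empty, so
  the symbols \<open>\<alpha>\<close> are in bijection with the columns that are not free.\<close>

lemma N_alpha_plus_free_cols:
  assumes "S \<in> staircase_tableaux n"
  shows "N_alpha S + card (alpha_free_cols n S) = n"
proof -
  let ?A = "{p. S p = Some Alpha}"
  have "inj_on snd ?A"
  proof (rule inj_onI)
    fix p q assume "p \<in> ?A" "q \<in> ?A" "snd p = snd q"
    moreover have "S (k, l) = Some Alpha \<Longrightarrow> S (k', l) = Some Alpha \<Longrightarrow> k = k'" for k k' l
      using tableau_above_Alpha[OF assms] by (metis linorder_neqE_nat option.distinct(1))
    ultimately show "p = q" by (cases p; cases q) auto
  qed
  then have "N_alpha S = card (snd ` ?A)"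
    by (simp add: N_alpha_def card_image)
  moreover have "snd ` ?A \<union> alpha_free_cols n S = {1..n}"
    using tableau_symbol_in_boxes[OF assms]
    by (fastforce simp: alpha_free_cols_def boxes_def image_iff)
  moreover have "snd ` ?A \<inter> alpha_free_cols n S = {}"
    by (auto simp: alpha_free_cols_def)
  ultimately show ?thesis
    by (metis card_Un_disjoint card_atLeastAtMost diff_Suc_1 finite_Un finite_atLeastAtMost)
qed

text \<open>The two conditions on tableaux are exchanged by transposing the diagram and swapping the
  symbols at the same time. This symmetry turns statements about columns and \<open>\<alpha>\<close> into
  statements about rows and \<open>\<beta>\<close>.\<close>

fun swap_symbol :: "symbol \<Rightarrow> symbol" where
  "swap_symbol Alpha = Beta"
| "swap_symbol Beta = Alpha"

definition reflect :: "filling \<Rightarrow> filling" where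
  "reflect S = (\<lambda>(k, l). map_option swap_symbol (S (l, k)))"

lemma swap_symbol_swap_symbol [simp]: "swap_symbol (swap_symbol s) = s"
  by (cases s) auto

lemma swap_symbol_eq [simp]: "swap_symbol s = Alpha \<longleftrightarrow> s = Beta" "swap_symbol s = Beta \<longleftrightarrow> s = Alpha"
  by (cases s; simp)+

lemma reflect_apply [simp]:
  "reflect S (k, l) = None \<longleftrightarrow> S (l, k) = None"
  "reflect S (k, l) = Some Alpha \<longleftrightarrow> S (l, k) = Some Beta"
  "reflect S (k, l) = Some Beta \<longleftrightarrow> S (l, k) = Some Alpha"
  by (auto simp: reflect_def)

lemma reflect_reflect [simp]: "reflect (reflect S) = S"
  by (auto simp: reflect_def fun_eq_iff option.map_comp o_def option.map_ident)

lemma reflect_in_tableaux [simp]: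
  "reflect S \<in> staircase_tableaux n \<longleftrightarrow> S \<in> staircase_tableaux n"
proof -
  have "reflect S \<in> staircase_tableaux n" if "S \<in> staircase_tableaux n" for S
  proof (rule tableauI)
    fix k l :: nat
    show "k = 0 \<or> l = 0 \<or> n + 1 < k + l \<Longrightarrow> reflect S (k, l) = None"
      using tableau_outside[OF that, of l k] by auto
    show "1 \<le> k \<Longrightarrow> 1 \<le> l \<Longrightarrow> k + l = n + 1 \<Longrightarrow> reflect S (k, l) \<noteq> None"
      using tableau_diagonal[OF that, of l k] by simp
    show "reflect S (k, l) = Some Beta \<Longrightarrow> l' < l \<Longrightarrow> reflect S (k, l') = None" for l'
      using tableau_above_Alpha[OF that, of l k l'] by simp
    show "reflect S (k, l) = Some Alpha \<Longrightarrow> k' < k \<Longrightarrow> reflect S (k', l) = None" for k'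
      using tableau_left_of_Beta[OF that, of l k k'] by simp
  qed
  from this[of S] this[of "reflect S"] show ?thesis by auto
qed

lemma alpha_free_cols_reflect [simp]: "alpha_free_cols n (reflect S) = beta_free_rows n S"
  by (simp add: alpha_free_cols_def beta_free_rows_def)

lemma beta_free_rows_reflect [simp]: "beta_free_rows n (reflect S) = alpha_free_cols n S"
  by (simp add: alpha_free_cols_def beta_free_rows_def)

lemma free_weight_reflect [simp]: "free_weight n x y (reflect S) = free_weight n y x S"
  by (simp add: free_weight_def)

lemma subtableau_reflect: "subtableau i j (reflect S) = reflect (subtableau j i S)"
  by (auto simp: subtableau_def reflect_def)

lemma N_beta_plus_free_rows:
  assumes "S \<in> staircase_tableaux n"
  shows "N_beta S + card (beta_free_rows n S) = n"
proof -
  have "{p. reflect S p = Some Alpha} = prod.swap ` {p. S p = Some Beta}"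
    by (force simp: image_iff)
  then have "N_alpha (reflect S) = N_beta S"
    by (simp add: N_alpha_def N_beta_def card_image)
  then show ?thesis
    using N_alpha_plus_free_cols[of "reflect S" n] assms by simp
qed

lemma weight_eq_free_weight:
  assumes "a > 0" "b > 0" and S: "S \<in> staircase_tableaux n"
  shows "weight a b S = (a * b) ^ n * free_weight n (inverse a) (inverse b) S"
proof -
  have pow: "c ^ n * inverse c ^ k = c ^ m" if "c > 0" "m + k = n" for c :: real and k m
    using that by (auto simp: power_add power_inverse)
  have "(a * b) ^ n * free_weight n (inverse a) (inverse b) S =
      (a ^ n * inverse a ^ card (alpha_free_cols n S)) *
      (b ^ n * inverse b ^ card (beta_free_rows n S))"
    by (simp only: free_weight_def power_mult_distrib mult_ac)
  also have "\<dots> = weight a b S"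
    by (simp only: pow[OF assms(1) N_alpha_plus_free_cols[OF S]]
        pow[OF assms(2) N_beta_plus_free_rows[OF S]] weight_def)
  finally show ?thesis ..
qed

section \<open>Adding a leftmost column\<close>

text \<open>The possible contents of a column whose symbols are confined to the rows in \<open>R\<close>; only the
  condition on \<open>\<alpha>\<close> acts within a column.\<close>

definition col_fillings :: "nat set \<Rightarrow> (nat \<Rightarrow> symbol option) set" where
  "col_fillings R = {c. (\<forall>k. k \<notin> R \<longrightarrow> c k = None) \<and>
     (\<forall>k. c k = Some Alpha \<longrightarrow> (\<forall>k'<k. c k' = None))}"

text \<open>The factor that a new leftmost column contributes to the free weight: the column itself may
  be free of \<open>\<alpha>\<close>, and a row of \<open>R\<close> stays free of \<open>\<beta>\<close> unless the column puts one there.\<close>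

definition col_weight :: "nat set \<Rightarrow> real \<Rightarrow> real \<Rightarrow> (nat \<Rightarrow> symbol option) \<Rightarrow> real" where
  "col_weight R x y c =
     (if \<exists>k. c k = Some Alpha then 1 else x) * y ^ card {k \<in> R. c k \<noteq> Some Beta}"

lemma finite_col_fillings:
  assumes "finite R" shows "finite (col_fillings R)"
proof (rule finite_subset)
  show "col_fillings R \<subseteq>
      {c. \<forall>k. (k \<in> R \<longrightarrow> c k \<in> {None, Some Alpha, Some Beta}) \<and> (k \<notin> R \<longrightarrow> c k = None)}"
  proof -
    have "s \<in> {None, Some Alpha, Some Beta}" for s :: "symbol option"
      by (cases s; cases "the s") auto
    then show ?thesis by (simp add: col_fillings_def subset_iff)
  qed
  show "finite \<dots>" using assms by (intro finite_set_of_finite_funs) auto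
qed

text \<open>Here \<open>m\<close> is the bottom row. An empty bottom box or a \<open>\<beta>\<close> in it imposes nothing on the
  boxes above, whereas an \<open>\<alpha>\<close> forces all of them to be empty.\<close>

lemma col_fillings_insert_bottom:
  assumes "\<forall>k\<in>R. k < m"
  shows "{c \<in> col_fillings (insert m R). c m = None} = col_fillings R"
    and "{c \<in> col_fillings (insert m R). c m \<noteq> None} =
      insert ((\<lambda>_. None)(m := Some Alpha)) ((\<lambda>c. c(m := Some Beta)) ` col_fillings R)"
proof -
  show "{c \<in> col_fillings (insert m R). c m = None} = col_fillings R"
  proof -
    have "m \<notin> R" using assms by auto
    then have "(\<forall>k. k \<notin> insert m R \<longrightarrow> c k = None) \<and> c m = None \<longleftrightarrow>
        (\<forall>k. k \<notin> R \<longrightarrow> c k = None)" for c :: "nat \<Rightarrow> symbol option"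
      by (metis insert_iff)
    then show ?thesis unfolding col_fillings_def by blast
  qed
  show "{c \<in> col_fillings (insert m R). c m \<noteq> None} =
      insert ((\<lambda>_. None)(m := Some Alpha)) ((\<lambda>c. c(m := Some Beta)) ` col_fillings R)"
    (is "?L = insert ?a ?B")
  proof (intro equalityI subsetI)
    fix c assume c: "c \<in> ?L"
    then have supp: "c k = None" if "k > m" for k
    proof -
      have "k \<notin> insert m R" using that assms by auto
      then show ?thesis using c by (simp add: col_fillings_def)
    qed
    from c obtain s where s: "c m = Some s" by auto
    show "c \<in> insert ?a ?B"
    proof (cases s)
      case Alpha
      then have "c = ?a"
        using c s supp by (auto simp: col_fillings_def fun_eq_iff) (metis linorder_neqE_nat)
      then show ?thesis by simp
    next
      case Beta
      have "c(m := None) \<in> col_fillings R"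
        using c assms by (auto simp: col_fillings_def)
      moreover have "c = (c(m := None))(m := Some Beta)"
        using s Beta by auto
      ultimately show ?thesis by blast
    qed
  next
    fix c assume "c \<in> insert ?a ?B"
    then consider "c = ?a" | d where "d \<in> col_fillings R" "c = d(m := Some Beta)" by blast
    then show "c \<in> ?L"
    proof cases
      case 1
      then show ?thesis by (auto simp: col_fillings_def)
    next
      case (2 d)
      have "k < m" if "d k = Some Alpha" for k
      proof -
        have "k \<in> R" using 2(1) that by (force simp: col_fillings_def)
        then show ?thesis using assms by blast
      qed
      then have "d k' = None \<and> k' \<noteq> m" if "d k = Some Alpha" "k' < k" for k k'
        using 2(1) that by (force simp: col_fillings_def)
      then show ?thesis using 2 by (auto simp: col_fillings_def)
    qed
  qed
qed

text \<open>A \<open>\<beta>\<close> in the bottom box leaves the weight of the part above unchanged; an \<open>\<alpha>\<close> leaves all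
  rows free, which gives the single monomial on the right.\<close>

lemma sum_col_weight_nonempty_bottom:
  assumes "finite R" "\<forall>k\<in>R. k < m"
  shows "(\<Sum>c | c \<in> col_fillings (insert m R) \<and> c m \<noteq> None. col_weight (insert m R) x y c) =
    (\<Sum>c\<in>col_fillings R. col_weight R x y c) + y ^ Suc (card R)"
proof -
  let ?a = "(\<lambda>_. None)(m := Some Alpha) :: nat \<Rightarrow> symbol option"
  let ?f = "\<lambda>c :: nat \<Rightarrow> symbol option. c(m := Some Beta)"
  have m: "m \<notin> R" using assms by auto
  then have cm: "c m = None" if "c \<in> col_fillings R" for c
    using that by (simp add: col_fillings_def)
  have inj: "inj_on ?f (col_fillings R)"
    by (rule inj_onI) (metis cm fun_upd_triv fun_upd_upd)
  have "?a \<notin> ?f ` col_fillings R"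
    by (auto simp: fun_eq_iff) (metis option.inject symbol.distinct(1))
  moreover have "col_weight (insert m R) x y (?f c) = col_weight R x y c"
    if "c \<in> col_fillings R" for c
  proof -
    have "?f c k = Some Alpha \<longleftrightarrow> c k = Some Alpha" for k
      using cm[OF that] by auto
    then have "(\<exists>k. ?f c k = Some Alpha) = (\<exists>k. c k = Some Alpha)"
      by blast
    moreover have "{k \<in> insert m R. ?f c k \<noteq> Some Beta} = {k \<in> R. c k \<noteq> Some Beta}"
      using m by auto
    ultimately show ?thesis by (simp only: col_weight_def)
  qed
  moreover have "col_weight (insert m R) x y ?a = y ^ Suc (card R)"
  proof -
    have "{k \<in> insert m R. ?a k \<noteq> Some Beta} = insert m R" by auto
    then show ?thesis using assms(1) m by (auto simp: col_weight_def)
  qed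
  ultimately show ?thesis
    unfolding col_fillings_insert_bottom(2)[OF assms(2)]
    using assms(1) by (simp add: finite_col_fillings sum.reindex[OF inj] add.commute)
qed

text \<open>The sum over the column fillings does not factor on its own. After the monomial for a column
  with \<open>\<alpha>\<close> in an additional bottom box is added, every new row multiplies the total by
  \<open>y + 1\<close>.\<close>

lemma sum_col_weight:
  assumes "finite R"
  shows "(\<Sum>c\<in>col_fillings R. col_weight R x y c) + y ^ Suc (card R) = (x + y) * (y + 1) ^ card R"
  using assms
proof (induction R rule: finite_linorder_max_induct)
  case empty
  have "col_fillings {} = {\<lambda>_. None}" by (auto simp: col_fillings_def)
  then show ?case by (simp add: col_weight_def)
next
  case (insert m R)
  let ?C = "col_fillings (insert m R)" and ?w = "col_weight (insert m R) x y"
  have m: "m \<notin> R" using insert.hyps by auto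
  have "?w c = y * col_weight R x y c" if "c \<in> col_fillings R" for c
  proof -
    have "{k \<in> insert m R. c k \<noteq> Some Beta} = insert m {k \<in> R. c k \<noteq> Some Beta}"
      using that m by (auto simp: col_fillings_def)
    then show ?thesis using insert.hyps(1) m by (simp add: col_weight_def)
  qed
  then have "(\<Sum>c | c \<in> ?C \<and> c m = None. ?w c) = y * (\<Sum>c\<in>col_fillings R. col_weight R x y c)"
    using col_fillings_insert_bottom(1)[OF insert.hyps(2)] by (simp add: sum_distrib_left)
  moreover have "(\<Sum>c | c \<in> ?C \<and> c m \<noteq> None. ?w c) =
      (\<Sum>c\<in>col_fillings R. col_weight R x y c) + y ^ Suc (card R)"
    by (rule sum_col_weight_nonempty_bottom[OF insert.hyps])
  moreover have "(\<Sum>c\<in>?C. ?w c) =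
      (\<Sum>c | c \<in> ?C \<and> c m = None. ?w c) + (\<Sum>c | c \<in> ?C \<and> c m \<noteq> None. ?w c)"
    using insert.hyps(1)
    by (subst sum.union_disjoint[symmetric]) (auto simp: finite_col_fillings intro!: sum.cong)
  ultimately have "(\<Sum>c\<in>?C. ?w c) + y ^ Suc (card (insert m R)) =
      (y + 1) * ((\<Sum>c\<in>col_fillings R. col_weight R x y c) + y ^ Suc (card R))"
    using insert.hyps(1) m by (simp add: algebra_simps)
  also have "\<dots> = (x + y) * (y + 1) ^ card (insert m R)"
    using insert.hyps(1) m insert.IH by simp
  finally show ?case .
qed

definition add_col :: "(nat \<Rightarrow> symbol option) \<Rightarrow> filling \<Rightarrow> filling" where
  "add_col c T = (\<lambda>(k, l). if l = 0 then None else if l = 1 then c k else T (k, l - 1))"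

lemma add_col_apply [simp]:
  "add_col c T (k, 0) = None" "add_col c T (k, Suc 0) = c k"
  "add_col c T (k, Suc (Suc l)) = T (k, Suc l)"
  by (simp_all add: add_col_def)

lemma subtableau_apply:
  "subtableau i j S (k, l) = (if 1 \<le> k \<and> 1 \<le> l then S (k + (i - 1), l + (j - 1)) else None)"
  by (simp add: subtableau_def)

lemma subtableau_one_two_in_tableaux:
  assumes S: "S \<in> staircase_tableaux (Suc n)"
  shows "subtableau 1 2 S \<in> staircase_tableaux n"
proof (rule tableauI)
  fix k l :: nat assume "k = 0 \<or> l = 0 \<or> n + 1 < k + l"
  then show "subtableau 1 2 S (k, l) = None"
    using tableau_outside[OF S, of k "l + 1"] by (auto simp: subtableau_apply)
next
  fix k l :: nat assume "1 \<le> k" "1 \<le> l" "k + l = n + 1"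
  then show "subtableau 1 2 S (k, l) \<noteq> None"
    using tableau_diagonal[OF S, of k "l + 1"] by (auto simp: subtableau_apply)
next
  fix k l l' assume "subtableau 1 2 S (k, l) = Some Beta" "l' < l"
  then show "subtableau 1 2 S (k, l') = None"
    using tableau_left_of_Beta[OF S, of k "l + 1" "l' + 1"]
    by (auto simp: subtableau_apply split: if_splits)
next
  fix k l k' assume "subtableau 1 2 S (k, l) = Some Alpha" "k' < k"
  then show "subtableau 1 2 S (k', l) = None"
    using tableau_above_Alpha[OF S, of k "l + 1" k']
    by (auto simp: subtableau_apply split: if_splits)
qed

text \<open>A \<open>\<beta>\<close> of \<open>T\<close> forces the new box in its row to be empty. A symbol of the new column has
  nothing to its left, so the remaining rows are restricted only by the condition on
  \<open>\<alpha>\<close> within the column, and by the bottom box lying on the diagonal.\<close>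

lemma tableaux_over_subtableau:
  assumes T: "T \<in> staircase_tableaux n"
  shows "{S \<in> staircase_tableaux (Suc n). subtableau 1 2 S = T} = (\<lambda>c. add_col c T) `
    {c \<in> col_fillings (insert (Suc n) (beta_free_rows n T)). c (Suc n) \<noteq> None}"
    (is "?L = _ ` ?C")
proof (intro equalityI subsetI)
  fix S assume "S \<in> ?L"
  then have S: "S \<in> staircase_tableaux (Suc n)" and sub: "subtableau 1 2 S = T" by auto
  define c where "c = (\<lambda>k. S (k, 1))"
  have "S p = add_col c T p" for p
  proof (cases p)
    case (Pair k l)
    have "S (k, l) = add_col c T (k, l)"
      using tableau_outside[OF S] sub[symmetric]
      by (auto simp: add_col_def c_def subtableau_apply)
    then show ?thesis using Pair by simp
  qed
  then have "S = add_col c T" by blast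
  moreover have "c \<in> col_fillings (insert (Suc n) (beta_free_rows n T))"
    unfolding col_fillings_def
  proof (intro CollectI conjI allI impI)
    fix k assume k: "k \<notin> insert (Suc n) (beta_free_rows n T)"
    show "c k = None"
    proof (cases "k \<in> {1..n}")
      case True
      then obtain l where "T (k, l) = Some Beta" using k by (auto simp: beta_free_rows_def)
      then have "S (k, l + 1) = Some Beta" "l > 0"
        using sub by (auto simp: subtableau_apply split: if_splits)
      then show ?thesis using tableau_left_of_Beta[OF S, of k "l + 1" 1] by (simp add: c_def)
    next
      case False
      then show ?thesis using k tableau_outside[OF S, of k 1] by (auto simp: c_def)
    qed
  next
    fix k k' assume "c k = Some Alpha" "k' < k"
    then show "c k' = None" using tableau_above_Alpha[OF S] by (simp add: c_def)
  qed
  moreover have "c (Suc n) \<noteq> None"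
    using tableau_diagonal[OF S, of "Suc n" 1] by (simp add: c_def)
  ultimately show "S \<in> (\<lambda>c. add_col c T) ` ?C" by blast
next
  fix S assume "S \<in> (\<lambda>c. add_col c T) ` ?C"
  then obtain c where c: "c \<in> col_fillings (insert (Suc n) (beta_free_rows n T))"
    "c (Suc n) \<noteq> None" and S: "S = add_col c T" by auto
  have c0: "c k = None" if "k = 0 \<or> k > Suc n" for k
    using c(1) that by (auto simp: col_fillings_def beta_free_rows_def)
  have cT: "c k = None" if "T (k, l) = Some Beta" for k l
  proof -
    have "k \<notin> insert (Suc n) (beta_free_rows n T)"
      using that tableau_symbol_in_boxes[OF T that] by (auto simp: beta_free_rows_def boxes_def)
    then show ?thesis using c(1) by (simp add: col_fillings_def)
  qed
  have "S \<in> staircase_tableaux (Suc n)"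
  proof (rule tableauI)
    fix k l assume "k = 0 \<or> l = 0 \<or> Suc n + 1 < k + l"
    then show "S (k, l) = None"
      using c0 tableau_outside[OF T, of k "l - 1"] by (cases l) (auto simp: S add_col_def)
  next
    fix k l :: nat assume "1 \<le> k" "1 \<le> l" "k + l = Suc n + 1"
    then show "S (k, l) \<noteq> None"
      using c(2) tableau_diagonal[OF T, of k "l - 1"] by (cases "l = 1") (auto simp: S add_col_def)
  next
    fix k l l' assume "S (k, l) = Some Beta" "l' < l"
    then show "S (k, l') = None"
      using cT tableau_left_of_Beta[OF T, of k "l - 1" "l' - 1"]
      by (auto simp: S add_col_def split: if_splits)
  next
    fix k l k' assume "S (k, l) = Some Alpha" "k' < k"
    then show "S (k', l) = None"
      using c(1) tableau_above_Alpha[OF T, of k "l - 1" k']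
      by (auto simp: S add_col_def col_fillings_def split: if_splits)
  qed
  moreover have "subtableau 1 2 S = T"
    using tableau_outside[OF T] by (auto simp: fun_eq_iff subtableau_apply S add_col_def)
  ultimately show "S \<in> ?L" by simp
qed

lemma free_weight_add_col:
  assumes T: "T \<in> staircase_tableaux n"
    and c: "c \<in> col_fillings (insert (Suc n) (beta_free_rows n T))"
  shows "free_weight (Suc n) x y (add_col c T) =
    x ^ card (alpha_free_cols n T) * col_weight (insert (Suc n) (beta_free_rows n T)) x y c"
proof -
  have "alpha_free_cols (Suc n) (add_col c T) =
      (if \<exists>k. c k = Some Alpha then {} else {1}) \<union> Suc ` alpha_free_cols n T"
  proof (rule set_eqI)
    fix l
    show "l \<in> alpha_free_cols (Suc n) (add_col c T) \<longleftrightarrow>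
        l \<in> (if \<exists>k. c k = Some Alpha then {} else {1}) \<union> Suc ` alpha_free_cols n T"
      by (cases l; cases "l - 1") (auto simp: alpha_free_cols_def)
  qed
  moreover have "1 \<notin> Suc ` alpha_free_cols n T"
    by (auto simp: alpha_free_cols_def)
  ultimately have "x ^ card (alpha_free_cols (Suc n) (add_col c T)) =
      (if \<exists>k. c k = Some Alpha then 1 else x) * x ^ card (alpha_free_cols n T)"
    by (simp add: card_image)
  moreover have "beta_free_rows (Suc n) (add_col c T) =
      {k \<in> insert (Suc n) (beta_free_rows n T). c k \<noteq> Some Beta}"
  proof (rule set_eqI)
    fix k
    have T': "T (k, l) \<noteq> Some Beta" if "k = Suc n \<or> l = 0" for l
      using tableau_outside[OF T, of k l] that by fastforce
    have "(\<forall>l. add_col c T (k, l) \<noteq> Some Beta) \<longleftrightarrow>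
        c k \<noteq> Some Beta \<and> (\<forall>l. T (k, l) \<noteq> Some Beta)"
    proof -
      have "(\<forall>l. add_col c T (k, l) \<noteq> Some Beta) \<longleftrightarrow>
          c k \<noteq> Some Beta \<and> (\<forall>l. T (k, Suc l) \<noteq> Some Beta)"
        by (metis add_col_apply not0_implies_Suc option.distinct(1))
      then show ?thesis using T' by (metis not0_implies_Suc)
    qed
    then show "k \<in> beta_free_rows (Suc n) (add_col c T) \<longleftrightarrow>
        k \<in> {k \<in> insert (Suc n) (beta_free_rows n T). c k \<noteq> Some Beta}"
      using T' by (auto simp: beta_free_rows_def le_Suc_eq)
  qed
  ultimately show ?thesis by (simp add: free_weight_def col_weight_def)
qed

text \<open>The rows of \<open>T\<close> without \<open>\<beta>\<close> enter the weight only through the new column, whose total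
  contribution turns the power of \<open>y\<close> into the same power of \<open>y + 1\<close>. The remaining
  factor \<open>x + y\<close> does not depend on \<open>T\<close> and so disappears on normalizing.\<close>

lemma sum_free_weight_delete_col:
  assumes T: "T \<in> staircase_tableaux n"
  shows "(\<Sum>S | S \<in> staircase_tableaux (Suc n) \<and> subtableau 1 2 S = T. free_weight (Suc n) x y S) =
    (x + y) * free_weight n x (y + 1) T"
proof -
  let ?R = "beta_free_rows n T"
  have "inj (\<lambda>c. add_col c T)"
    by (rule injI) (metis add_col_apply(2) ext)
  then have "(\<Sum>S | S \<in> staircase_tableaux (Suc n) \<and> subtableau 1 2 S = T. free_weight (Suc n) x y S) =
      (\<Sum>c | c \<in> col_fillings (insert (Suc n) ?R) \<and> c (Suc n) \<noteq> None.
        free_weight (Suc n) x y (add_col c T))"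
    unfolding tableaux_over_subtableau[OF T]
    by (simp add: sum.reindex inj_on_subset)
  also have "\<dots> = x ^ card (alpha_free_cols n T) *
      (\<Sum>c | c \<in> col_fillings (insert (Suc n) ?R) \<and> c (Suc n) \<noteq> None.
        col_weight (insert (Suc n) ?R) x y c)"
    by (simp add: free_weight_add_col[OF T] sum_distrib_left)
  also have "(\<Sum>c | c \<in> col_fillings (insert (Suc n) ?R) \<and> c (Suc n) \<noteq> None.
        col_weight (insert (Suc n) ?R) x y c) = (x + y) * (y + 1) ^ card ?R"
    by (subst sum_col_weight_nonempty_bottom) (auto simp: beta_free_rows_def sum_col_weight[symmetric])
  finally show ?thesis by (simp add: free_weight_def)
qed

lemma subtableau_two_one_in_tableaux:
  "S \<in> staircase_tableaux (Suc n) \<Longrightarrow> subtableau 2 1 S \<in> staircase_tableaux n"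
  using subtableau_one_two_in_tableaux[of "reflect S" n] by (simp add: subtableau_reflect)

lemma sum_free_weight_delete_row:
  assumes T: "T \<in> staircase_tableaux n"
  shows "(\<Sum>S | S \<in> staircase_tableaux (Suc n) \<and> subtableau 2 1 S = T. free_weight (Suc n) x y S) =
    (x + y) * free_weight n (x + 1) y T"
proof -
  have "(\<Sum>S | S \<in> staircase_tableaux (Suc n) \<and> subtableau 2 1 S = T. free_weight (Suc n) x y S) =
      (\<Sum>S | S \<in> staircase_tableaux (Suc n) \<and> subtableau 1 2 S = reflect T. free_weight (Suc n) y x S)"
    by (rule sum.reindex_bij_witness[where i = reflect and j = reflect])
       (auto simp: subtableau_reflect)
  also have "\<dots> = (x + y) * free_weight n (x + 1) y T"
    using sum_free_weight_delete_col[of "reflect T" n y x] T by (simp add: add.commute)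
  finally show ?thesis .
qed

section \<open>The law with inverse parameters\<close>

definition free_Z :: "nat \<Rightarrow> real \<Rightarrow> real \<Rightarrow> real" where
  "free_Z n x y = (\<Sum>S\<in>staircase_tableaux n. free_weight n x y S)"

definition free_law :: "nat \<Rightarrow> real \<Rightarrow> real \<Rightarrow> filling pmf" where
  "free_law n x y =
     embed_pmf (\<lambda>S. if S \<in> staircase_tableaux n then free_weight n x y S / free_Z n x y else 0)"

lemma free_weight_nonneg: "x \<ge> 0 \<Longrightarrow> y \<ge> 0 \<Longrightarrow> free_weight n x y S \<ge> 0"
  by (simp add: free_weight_def)

text \<open>The tableau with \<open>\<alpha>\<close> in every diagonal box and nothing else has free weight \<open>y ^ n\<close>.\<close>

lemma free_Z_pos_right:
  assumes "x \<ge> 0" "y > 0"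
  shows "free_Z n x y > 0"
proof -
  let ?S = "\<lambda>(i, j). if (i, j) \<in> boxes n \<and> i + j = n + 1 then Some Alpha else None"
  have "alpha_free_cols n ?S = {}"
  proof -
    have "\<exists>k. ?S (k, l) = Some Alpha" if "l \<in> {1..n}" for l
      by (rule exI[of _ "n + 1 - l"]) (use that in \<open>auto simp: boxes_def\<close>)
    then show ?thesis unfolding alpha_free_cols_def by blast
  qed
  then have "free_weight n x y ?S > 0"
    using assms by (simp add: free_weight_def)
  moreover have "?S \<in> staircase_tableaux n"
    by (auto simp: staircase_tableaux_def split: if_splits)
  ultimately show ?thesis
    unfolding free_Z_def using assms
    by (intro sum_pos2[OF finite_staircase_tableaux]) (auto intro: free_weight_nonneg)
qed

lemma free_Z_swap: "free_Z n x y = free_Z n y x"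
  unfolding free_Z_def
  by (rule sum.reindex_bij_witness[where i = reflect and j = reflect]) auto

lemma free_Z_pos:
  assumes "x \<ge> 0" "y \<ge> 0" "x + y > 0"
  shows "free_Z n x y > 0"
proof (cases "y > 0")
  case True
  with assms show ?thesis by (simp add: free_Z_pos_right)
next
  case False
  with assms show ?thesis by (subst free_Z_swap, intro free_Z_pos_right) auto
qed

lemma pmf_free_law:
  assumes "x \<ge> 0" "y \<ge> 0" "x + y > 0"
  shows "pmf (free_law n x y) S =
    (if S \<in> staircase_tableaux n then free_weight n x y S / free_Z n x y else 0)"
  unfolding free_law_def
proof (rule pmf_embed_finite)
  show "(\<Sum>S\<in>staircase_tableaux n. free_weight n x y S / free_Z n x y) = 1"
    using free_Z_pos[OF assms, of n]
    by (simp add: sum_divide_distrib[symmetric] free_Z_def[symmetric])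
qed (use assms in \<open>auto intro!: finite_staircase_tableaux divide_nonneg_pos free_weight_nonneg free_Z_pos\<close>)

lemma pmf_map_finite_support:
  assumes "finite X" "\<And>x. x \<notin> X \<Longrightarrow> pmf p x = 0"
  shows "pmf (map_pmf f p) y = (\<Sum>x | x \<in> X \<and> f x = y. pmf p x)"
proof -
  have supp: "x \<in> X" if "pmf p x \<noteq> 0" for x
    using that assms(2) by blast
  have "pmf (map_pmf f p) y = measure (measure_pmf p) {x \<in> X. f x = y}"
    unfolding pmf_map
    by (rule measure_pmf.finite_measure_eq_AE)
       (auto simp: AE_measure_pmf_iff set_pmf_iff supp)
  then show ?thesis using assms(1) by (simp add: measure_measure_pmf_finite)
qed

text \<open>If the sums of the weights over the fibres of \<open>f\<close> are proportional to the new weights, then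
  the constant of proportionality is also the quotient of the normalizations and cancels.\<close>

lemma map_free_law:
  assumes xy: "x \<ge> 0" "y \<ge> 0" "x + y > 0" "x' \<ge> 0" "y' \<ge> 0" "x' + y' > 0" and C: "C > 0"
    and f: "\<And>S. S \<in> staircase_tableaux n \<Longrightarrow> f S \<in> staircase_tableaux m"
    and sum: "\<And>T. T \<in> staircase_tableaux m \<Longrightarrow>
      (\<Sum>S | S \<in> staircase_tableaux n \<and> f S = T. free_weight n x y S) = C * free_weight m x' y' T"
  shows "map_pmf f (free_law n x y) = free_law m x' y'"
proof (rule pmf_eqI)
  fix T
  have pmf: "pmf (map_pmf f (free_law n x y)) T =
      (\<Sum>S | S \<in> staircase_tableaux n \<and> f S = T. free_weight n x y S / free_Z n x y)"
    by (subst pmf_map_finite_support[OF finite_staircase_tableaux[of n]])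
       (auto simp: pmf_free_law xy)
  have "free_Z n x y = (\<Sum>T\<in>staircase_tableaux m.
      \<Sum>S | S \<in> staircase_tableaux n \<and> f S = T. free_weight n x y S)"
    unfolding free_Z_def
    by (rule sum.group[symmetric]) (auto simp: finite_staircase_tableaux f)
  also have "\<dots> = C * free_Z m x' y'"
    by (simp add: sum free_Z_def sum_distrib_left)
  finally have Z: "free_Z n x y = C * free_Z m x' y'" .
  show "pmf (map_pmf f (free_law n x y)) T = pmf (free_law m x' y') T"
  proof (cases "T \<in> staircase_tableaux m")
    case True
    then show ?thesis using C
      by (simp add: pmf sum_divide_distrib[symmetric] sum Z pmf_free_law xy)
  next
    case False
    then have empty: "{S. S \<in> staircase_tableaux n \<and> f S = T} = {}" using f by auto
    show ?thesis unfolding pmf empty by (simp add: pmf_free_law xy False)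
  qed
qed

lemma subtableau_one_one:
  assumes "S \<in> staircase_tableaux n"
  shows "subtableau 1 1 S = S"
proof -
  have "subtableau 1 1 S (k, l) = S (k, l)" for k l
    using tableau_outside[OF assms, of k l] by (auto simp: subtableau_apply)
  then show ?thesis by (simp add: fun_eq_iff)
qed

lemma subtableau_delete_col: "subtableau i (Suc (Suc q)) = subtableau 1 2 \<circ> subtableau i (Suc q)"
  by (auto simp: fun_eq_iff subtableau_apply)

lemma subtableau_delete_row: "subtableau (Suc (Suc p)) j = subtableau 2 1 \<circ> subtableau (Suc p) j"
  by (auto simp: fun_eq_iff subtableau_apply)

text \<open>Rows and columns are removed one at a time; the first step needs \<open>x + y > 0\<close>, and the later
  ones inherit it because the parameters only increase.\<close>

lemma map_subtableau_free_law:
  assumes xy: "x \<ge> 0" "y \<ge> 0" "x + y > 0"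
  shows "map_pmf (subtableau (Suc p) (Suc q)) (free_law (m + p + q) x y) =
    free_law m (x + real p) (y + real q)"
proof (induction q arbitrary: m)
  case 0
  show ?case
  proof (induction p arbitrary: m)
    case 0
    have "map_pmf (subtableau 1 1) (free_law m x y) = map_pmf id (free_law m x y)"
      by (rule map_pmf_cong)
         (auto simp: set_pmf_iff pmf_free_law xy intro!: subtableau_one_one[simplified] split: if_splits)
    then show ?case by (simp add: pmf.map_id)
  next
    case (Suc p)
    have "map_pmf (subtableau (Suc (Suc p)) (Suc 0)) (free_law (m + Suc p + 0) x y) =
        map_pmf (subtableau 2 1) (map_pmf (subtableau (Suc p) (Suc 0)) (free_law (Suc m + p + 0) x y))"
      by (simp add: pmf.map_comp subtableau_delete_row)
    also have "\<dots> = map_pmf (subtableau 2 1) (free_law (Suc m) (x + real p) (y + real 0))"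
      using Suc.IH[of "Suc m"] by simp
    also have "\<dots> = free_law m (x + real (Suc p)) (y + real 0)"
      using xy
      by (intro map_free_law[where C = "(x + real p) + (y + real 0)"])
         (auto simp: subtableau_two_one_in_tableaux[simplified] add_pos_nonneg
           sum_free_weight_delete_row[simplified] algebra_simps)
    finally show ?case .
  qed
next
  case (Suc q)
  have "map_pmf (subtableau (Suc p) (Suc (Suc q))) (free_law (m + p + Suc q) x y) =
      map_pmf (subtableau 1 2) (map_pmf (subtableau (Suc p) (Suc q)) (free_law (Suc m + p + q) x y))"
    by (simp add: pmf.map_comp subtableau_delete_col)
  also have "\<dots> = map_pmf (subtableau 1 2) (free_law (Suc m) (x + real p) (y + real q))"
    using Suc.IH[of "Suc m"] by simp
  also have "\<dots> = free_law m (x + real p) (y + real (Suc q))"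
    using xy
    by (intro map_free_law[where C = "(x + real p) + (y + real q)"])
       (auto simp: subtableau_one_two_in_tableaux[simplified] add_pos_nonneg
         sum_free_weight_delete_col[simplified] algebra_simps)
  finally show ?case .
qed

section \<open>Infinite parameters\<close>

text \<open>The probabilities are quotients of polynomials, with a denominator that does not vanish at
  the limit point.\<close>

lemma tendsto_pmf_free_law:
  assumes f: "(f \<longlongrightarrow> x) F" and g: "(g \<longlongrightarrow> y) F"
    and pos: "\<forall>\<^sub>F t in F. f t \<ge> 0 \<and> g t \<ge> 0 \<and> f t + g t > 0"
    and xy: "x \<ge> 0" "y \<ge> 0" "x + y > 0"
  shows "((\<lambda>t. pmf (free_law n (f t) (g t)) S) \<longlongrightarrow> pmf (free_law n x y) S) F"
proof (cases "S \<in> staircase_tableaux n")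
  case True
  have w: "((\<lambda>t. free_weight n (f t) (g t) S) \<longlongrightarrow> free_weight n x y S) F" for S
    unfolding free_weight_def by (intro tendsto_intros f g)
  have "((\<lambda>t. free_weight n (f t) (g t) S / free_Z n (f t) (g t)) \<longlongrightarrow>
      free_weight n x y S / free_Z n x y) F"
    using free_Z_pos[OF xy, of n] unfolding free_Z_def by (intro tendsto_intros w) auto
  moreover have "\<forall>\<^sub>F t in F. pmf (free_law n (f t) (g t)) S =
      free_weight n (f t) (g t) S / free_Z n (f t) (g t)"
    using pos by eventually_elim (simp add: pmf_free_law True)
  ultimately show ?thesis using True by (simp add: pmf_free_law xy tendsto_cong)
next
  case False
  have "\<forall>\<^sub>F t in F. pmf (free_law n (f t) (g t)) S = 0"
    using pos by eventually_elim (simp add: pmf_free_law False)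
  then show ?thesis using False by (simp add: pmf_free_law xy tendsto_eventually)
qed

lemma tableau_pmf_real_eq_free_law:
  assumes "a > 0" "b > 0"
  shows "tableau_pmf_real n a b = free_law n (inverse a) (inverse b)"
proof (rule pmf_eqI)
  fix S
  have "Z n a b = (a * b) ^ n * free_Z n (inverse a) (inverse b)"
    unfolding Z_def free_Z_def sum_distrib_left
    by (intro sum.cong refl weight_eq_free_weight assms)
  then show "pmf (tableau_pmf_real n a b) S = pmf (free_law n (inverse a) (inverse b)) S"
    using assms by (simp add: pmf_tableau_pmf_real pmf_free_law weight_eq_free_weight add_pos_pos)
qed

lemma pmf_eq_by_limit:
  fixes P :: "real \<Rightarrow> 'a pmf"
  assumes "\<And>x. ((\<lambda>t. pmf (P t) x) \<longlongrightarrow> pmf p x) at_top"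
    and "\<And>x. ((\<lambda>t. pmf (P t) x) \<longlongrightarrow> pmf q x) at_top"
  shows "p = q"
  using pmf_limit_eqI[of P p, OF assms(1)] pmf_limit_eqI[of P q, OF assms(2)] by simp

lemma tendsto_tableau_pmf_real:
  assumes fx: "(f \<longlongrightarrow> x) at_top" and gy: "(g \<longlongrightarrow> y) at_top"
    and pos: "\<And>t. t > 0 \<Longrightarrow> f t > 0 \<and> g t > 0"
    and xy: "x \<ge> 0" "y \<ge> 0" "x + y > 0"
  shows "((\<lambda>t::real. pmf (tableau_pmf_real n (inverse (f t)) (inverse (g t))) S)
    \<longlongrightarrow> pmf (free_law n x y) S) at_top"
proof (rule tendsto_cong[THEN iffD1, rotated])
  show "((\<lambda>t::real. pmf (free_law n (f t) (g t)) S) \<longlongrightarrow> pmf (free_law n x y) S) at_top"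
    by (rule tendsto_pmf_free_law[OF fx gy _ xy])
       (use pos in \<open>auto intro!: eventually_mono[OF eventually_gt_at_top[of 0]] add_pos_pos less_imp_le\<close>)
  show "\<forall>\<^sub>F t in at_top. pmf (free_law n (f t) (g t)) S =
      pmf (tableau_pmf_real n (inverse (f t)) (inverse (g t))) S"
    using eventually_gt_at_top[of 0]
    by eventually_elim (simp add: tableau_pmf_real_eq_free_law pos)
qed

lemma inverse_inverse_ennreal: "inverse (inverse (x :: ennreal)) = x"
proof (cases x)
  case (real r)
  then show ?thesis by (cases "r = 0") (simp_all add: inverse_ennreal)
qed simp

lemma enn2real_inverse: "x \<noteq> 0 \<Longrightarrow> x \<noteq> \<infinity> \<Longrightarrow> enn2real (inverse x) = inverse (enn2real x)"
  by (cases x) (auto simp: inverse_ennreal)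

lemma tableau_pmf_eq_free_law:
  assumes "0 < \<alpha>" "0 < \<beta>" "\<not> (\<alpha> = \<infinity> \<and> \<beta> = \<infinity>)"
  shows "tableau_pmf n \<alpha> \<beta> = free_law n (enn2real (inverse \<alpha>)) (enn2real (inverse \<beta>))"
proof -
  have pos: "0 < enn2real \<gamma>" if "0 < \<gamma>" "\<gamma> \<noteq> \<infinity>" for \<gamma>
    using that by (simp add: enn2real_positive_iff less_top)
  consider "\<alpha> \<noteq> \<infinity>" "\<beta> \<noteq> \<infinity>" | "\<alpha> = \<infinity>" "\<beta> \<noteq> \<infinity>" | "\<alpha> \<noteq> \<infinity>" "\<beta> = \<infinity>" using assms(3) by blast
  then show ?thesis
  proof cases
    case 1
    then show ?thesis using assms pos
      by (simp add: tableau_pmf_def tableau_pmf_real_eq_free_law enn2real_inverse)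
  next
    case 2
    have "tableau_pmf n \<infinity> \<beta> = free_law n 0 (inverse (enn2real \<beta>))"
    proof (rule pmf_eq_by_limit)
      show "((\<lambda>t. pmf (tableau_pmf_real n t (enn2real \<beta>)) S) \<longlongrightarrow> pmf (tableau_pmf n \<infinity> \<beta>) S) at_top" for S
        using assms(2) 2(2) by (rule tableau_pmf_alpha_infinity)
      show "((\<lambda>t. pmf (tableau_pmf_real n t (enn2real \<beta>)) S)
          \<longlongrightarrow> pmf (free_law n 0 (inverse (enn2real \<beta>))) S) at_top" for S
        using tendsto_tableau_pmf_real[OF tendsto_inverse_0_at_top[OF filterlim_ident] tendsto_const,
            of "inverse (enn2real \<beta>)" n S] pos[OF assms(2) 2(2)]
        by simp
    qed
    then show ?thesis using 2 assms by (simp add: enn2real_inverse)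
  next
    case 3
    have "tableau_pmf n \<alpha> \<infinity> = free_law n (inverse (enn2real \<alpha>)) 0"
    proof (rule pmf_eq_by_limit)
      show "((\<lambda>t. pmf (tableau_pmf_real n (enn2real \<alpha>) t) S) \<longlongrightarrow> pmf (tableau_pmf n \<alpha> \<infinity>) S) at_top" for S
        using assms(1) 3(1) by (rule tableau_pmf_beta_infinity)
      show "((\<lambda>t. pmf (tableau_pmf_real n (enn2real \<alpha>) t) S)
          \<longlongrightarrow> pmf (free_law n (inverse (enn2real \<alpha>)) 0) S) at_top" for S
        using tendsto_tableau_pmf_real[OF tendsto_const tendsto_inverse_0_at_top[OF filterlim_ident],
            of "inverse (enn2real \<alpha>)" n S] pos[OF assms(1) 3(1)]
        by simp
    qed
    then show ?thesis using 3 assms by (simp add: enn2real_inverse)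
  qed
qed

text \<open>A point probability of an image is a sum over a fibre, which may be infinite. A common finite
  support of the converging distributions carries over to the limit and reduces the fibre to
  finitely many points.\<close>

lemma tendsto_pmf_map_finite_support:
  assumes "finite X" and supp: "\<forall>\<^sub>F t in F. \<forall>x. x \<notin> X \<longrightarrow> pmf (P t) x = 0"
    and lim: "\<And>x. ((\<lambda>t. pmf (P t) x) \<longlongrightarrow> pmf p x) F" and F: "F \<noteq> bot"
  shows "((\<lambda>t. pmf (map_pmf f (P t)) y) \<longlongrightarrow> pmf (map_pmf f p) y) F"
proof -
  have "pmf p x = 0" if "x \<notin> X" for x
  proof -
    have "((\<lambda>t. pmf (P t) x) \<longlongrightarrow> 0) F"
      using supp by (intro tendsto_eventually) (auto elim!: eventually_mono simp: that)
    then show ?thesis using tendsto_unique[OF F lim] by blast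
  qed
  then have "pmf (map_pmf f p) y = (\<Sum>x | x \<in> X \<and> f x = y. pmf p x)"
    using assms(1) by (intro pmf_map_finite_support) auto
  moreover have "\<forall>\<^sub>F t in F. pmf (map_pmf f (P t)) y = (\<Sum>x | x \<in> X \<and> f x = y. pmf (P t) x)"
    using supp by eventually_elim (simp add: pmf_map_finite_support assms(1))
  ultimately show ?thesis
    by (simp add: tendsto_cong tendsto_sum lim)
qed

theorem theorem6p1:
  fixes \<alpha> \<beta> :: ennreal and n i j :: nat
  assumes "0 < \<alpha>" and "0 < \<beta>"
    and "1 \<le> n" and "\<alpha> = \<infinity> \<and> \<beta> = \<infinity> \<Longrightarrow> 2 \<le> n"
    and "1 \<le> i" and "1 \<le> j" and "i + j \<le> n + 1"
  shows "map_pmf (subtableau i j) (tableau_pmf n \<alpha> \<beta>) =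
    tableau_pmf (n + 2 - i - j)
      (inverse (inverse \<alpha> + of_nat (i - 1))) (inverse (inverse \<beta> + of_nat (j - 1)))"
proof -
  define p q m where "p = i - 1" and "q = j - 1" and "m = n + 2 - i - j"
  have ij: "i = Suc p" "j = Suc q" and n: "n = m + p + q"
    using assms by (auto simp: p_def q_def m_def)
  let ?a = "inverse (inverse \<alpha> + of_nat p)" and ?b = "inverse (inverse \<beta> + of_nat q)"
  have fin: "inverse \<gamma> + of_nat k \<noteq> \<infinity>" if "0 < \<gamma>" for \<gamma> :: ennreal and k
    using that by (simp add: ennreal_inverse_eq_top_iff of_nat_less_top less_top[symmetric])
  have real: "enn2real (inverse \<gamma> + of_nat k) = enn2real (inverse \<gamma>) + real k" if "0 < \<gamma>" for \<gamma> k
    using fin[OF that, of 0] by (subst enn2real_plus) (auto simp: less_top[symmetric])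
  have hat_pos: "0 < inverse (inverse \<gamma> + of_nat k)" if "0 < \<gamma>" for \<gamma> :: ennreal and k
    using fin[OF that] by (simp add: ennreal_inverse_positive)
  have hat: "tableau_pmf m ?a ?b =
      free_law m (enn2real (inverse \<alpha>) + real p) (enn2real (inverse \<beta>) + real q)"
    if "\<not> (\<alpha> = \<infinity> \<and> \<beta> = \<infinity> \<and> p = 0 \<and> q = 0)"
  proof -
    have "\<not> (?a = \<infinity> \<and> ?b = \<infinity>)"
      using that by auto
    then show ?thesis
      using tableau_pmf_eq_free_law[of ?a ?b m] hat_pos assms(1,2) by (simp add: real inverse_inverse_ennreal)
  qed
  have "map_pmf (subtableau i j) (tableau_pmf n \<alpha> \<beta>) = tableau_pmf m ?a ?b"
  proof (cases "\<alpha> = \<infinity> \<and> \<beta> = \<infinity>")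
    case False
    have "enn2real (inverse \<alpha>) + enn2real (inverse \<beta>) > 0"
    proof -
      have "0 < enn2real (inverse \<gamma>)" if "0 < \<gamma>" "\<gamma> \<noteq> \<infinity>" for \<gamma>
        using that fin[of \<gamma> 0] by (simp add: enn2real_positive_iff less_top[symmetric] ennreal_inverse_positive)
      then show ?thesis
        using False assms(1,2) by (metis add_pos_nonneg add_nonneg_pos enn2real_nonneg)
    qed
    moreover have "tableau_pmf m ?a ?b =
        free_law m (enn2real (inverse \<alpha>) + real p) (enn2real (inverse \<beta>) + real q)"
      using hat False by blast
    ultimately show ?thesis
      using False assms(1,2)
      by (simp add: tableau_pmf_eq_free_law ij n map_subtableau_free_law)
  next
    case True
    \<comment> \<open>The identity holds for \<open>\<alpha> = \<beta> = t\<close>, and both sides converge as \<open>t\<close> tends to infinity.\<close>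
    have P: "map_pmf (subtableau i j) (tableau_pmf_real n t t) =
        free_law m (inverse t + real p) (inverse t + real q)" if "t > 0" for t
      using that by (simp add: tableau_pmf_real_eq_free_law ij n map_subtableau_free_law)
    show ?thesis
    proof (rule pmf_eq_by_limit)
      show "((\<lambda>t. pmf (map_pmf (subtableau i j) (tableau_pmf_real n t t)) S)
          \<longlongrightarrow> pmf (map_pmf (subtableau i j) (tableau_pmf n \<alpha> \<beta>)) S) at_top" for S
      proof (rule tendsto_pmf_map_finite_support[OF finite_staircase_tableaux[of n]])
        show "\<forall>\<^sub>F t in at_top. \<forall>S. S \<notin> staircase_tableaux n \<longrightarrow> pmf (tableau_pmf_real n t t) S = 0"
          using eventually_gt_at_top[of 0] by eventually_elim (simp add: pmf_tableau_pmf_real)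
      qed (use True tableau_pmf_both_infinity in auto)
      show "((\<lambda>t. pmf (map_pmf (subtableau i j) (tableau_pmf_real n t t)) S)
          \<longlongrightarrow> pmf (tableau_pmf m ?a ?b) S) at_top" for S
      \<comment> \<open>The limit point \<open>(p, q)\<close> lies in the region of continuity of the free law as soon as a row
        or a column is deleted; otherwise both new parameters are still infinite.\<close>
      proof (cases "p = 0 \<and> q = 0")
        case pq: True
        have ev: "\<forall>\<^sub>F t in at_top. pmf (tableau_pmf_real m t t) S =
            pmf (map_pmf (subtableau i j) (tableau_pmf_real n t t)) S"
          using eventually_gt_at_top[of 0]
          by eventually_elim (simp only: P, simp add: pq tableau_pmf_real_eq_free_law)
        have inf: "?a = \<infinity>" "?b = \<infinity>" using True pq by auto
        show ?thesis
          unfolding inf by (rule tendsto_cong[OF ev, THEN iffD1]) (rule tableau_pmf_both_infinity)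
      next
        case pq: False
        have inv0: "(inverse \<longlongrightarrow> (0::real)) at_top"
          by (rule tendsto_inverse_0_at_top) (rule filterlim_ident)
        have lim: "((\<lambda>t. inverse t + real k) \<longlongrightarrow> real k) at_top" for k
          using tendsto_add[OF inv0 tendsto_const[of "real k"]] by simp
        have free: "((\<lambda>t. pmf (free_law m (inverse t + real p) (inverse t + real q)) S)
            \<longlongrightarrow> pmf (free_law m (real p) (real q)) S) at_top"
        proof (rule tendsto_pmf_free_law[OF lim lim])
          show "\<forall>\<^sub>F t in at_top. 0 \<le> inverse t + real p \<and> 0 \<le> inverse t + real q \<and>
              0 < inverse t + real p + (inverse t + real q)"
            using eventually_gt_at_top[of 0] by eventually_elim (auto simp: add_pos_nonneg)
        qed (use pq in auto)
        have ev: "\<forall>\<^sub>F t in at_top. pmf (free_law m (inverse t + real p) (inverse t + real q)) S =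
            pmf (map_pmf (subtableau i j) (tableau_pmf_real n t t)) S"
          using eventually_gt_at_top[of 0] by eventually_elim (simp add: P)
        have "tableau_pmf m ?a ?b = free_law m (real p) (real q)"
          using hat pq True by auto
        then show ?thesis
          by (simp only:) (rule tendsto_cong[OF ev, THEN iffD1, OF free])
      qed
    qed
  qed
  then show ?thesis by (simp add: p_def q_def m_def)
qed

end
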